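(* Let $n\ge2$, $0<s<1$, $0<p<\infty$ with $sp<n$, and let $q\in\big(0,\frac{np}{n-sp}\big)$. Then there exists a function $u\in\dot{W}^{s,p}_q(\mathbb{R}^n)$ such that $u-c\in L^p(\mathbb{R}^n)$ for no $c\in\mathbb{R}$.
   Context: $u\in\dot{W}^{s,p}_q(\mathbb{R}^n)$ means that $u:\mathbb{R}^n\to\mathbb{R}$ is measurable and $\int_{\mathbb{R}^n}\Big(\int_{\mathbb{R}^n}\frac{|u(x)-u(y)|^q}{|x-y|^{n+sq}}\,dy\Big)^{p/q}dx<\infty$. *)

theory Defs
  imports "HOL-Analysis.Analysis"
begin

(* The power a^e on [0, \<infinity>] for exponents e > 0 (the only ones used), so \<infinity>^e = \<infinity>. *)
definition ennreal_powr :: "ennreal \<Rightarrow> real \<Rightarrow> ennreal" where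
  "ennreal_powr a e = (if a = \<infinity> then \<infinity> else ennreal (enn2real a powr e))"

(* At y = x the integrand takes the value 0 (0 powr q = 0 and 0 / 0 = 0); this only
   concerns a null set of y. *)
definition homogeneous_W :: "real \<Rightarrow> real \<Rightarrow> real \<Rightarrow> (real ^ 'n \<Rightarrow> real) set" where
  "homogeneous_W s p q =
    {u. u \<in> borel_measurable lebesgue \<and>
        (\<integral>\<^sup>+x. ennreal_powr
            (\<integral>\<^sup>+y. ennreal (\<bar>u x - u y\<bar> powr q / norm (x - y) powr (real CARD('n) + s * q))
               \<partial>lebesgue)
            (p / q) \<partial>lebesgue) < \<infinity>}"

definition L_space :: "real \<Rightarrow> (real ^ 'n \<Rightarrow> real) set" where
  "L_space p =
    {f. f \<in> borel_measurable lebesgue \<and> (\<integral>\<^sup>+x. ennreal (\<bar>f x\<bar> powr p) \<partial>lebesgue) < \<infinity>}"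

end

theory Submission
  imports Defs
begin

text \<open>
  The witness is \<open>u x = (1 + \<bar>x\<bar>) powr - a\<close> with an exponent \<open>a\<close> chosen so slow that \<open>u\<close> misses
  \<open>L\<^sup>p\<close>, while its differences still decay fast enough. Write \<open>D x\<close> for the inner integral and
  \<open>r = 1 + \<bar>x\<bar>\<close>.

  Three effects contribute to \<open>D x\<close>. Points \<open>y\<close> within \<open>r/2\<close> of \<open>x\<close> see the slope of \<open>u\<close>, which
  is of order \<open>r\<close> to the power \<open>-a-1\<close>; since \<open>s < 1\<close> the kernel is integrable against it. Distant
  points with \<open>\<bar>y\<bar> > r\<close> contribute through the tail of the kernel, integrable because \<open>s > 0\<close>.
  In these two regions scaling gives the order \<open>r\<close> to the power \<open>-(a+s)q\<close>. The remaining points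
  see the bulk of \<open>u\<close> near the origin, at distance at least \<open>r/2\<close>: if \<open>a q < n\<close>, then the
  integral of \<open>u\<^sup>q\<close> over the ball of radius \<open>r\<close> grows like \<open>r\<close> to the power \<open>n - a q\<close>, and
  the same order results. So \<open>D x\<close> is at most a multiple of \<open>r\<close> to the power \<open>-(a+s)q\<close>
  (lemma \<open>gagliardo_inner_integral_decay\<close>), and the outer integral converges as soon as
  \<open>(a+s)p > n\<close>. On the other hand \<open>u - c\<close> is not in \<open>L\<^sup>p\<close> when \<open>a p < n\<close>, because a ball of
  radius \<open>R\<close> at distance \<open>2R\<close> from the origin already carries a multiple of \<open>R\<close> to the power
  \<open>n - a p\<close> (lemma \<open>nn_integral_powr_slow_decay_infinite\<close>); a nonzero \<open>c\<close> only makes the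
  function larger at infinity.

  What is needed is thus some \<open>a > 0\<close> with \<open>n/p - s < a < min (n/p) (n/q)\<close>. The left end is
  positive because \<open>s p < n\<close>, and it lies below \<open>n/q\<close> precisely because \<open>q < n p / (n - s p)\<close>.
\<close>

section \<open>Integrals of powers of the distance\<close>

lemma dyadic_bracket:
  fixes z :: real
  assumes "z \<ge> 1"
  shows "\<exists>k::nat. 2 ^ k \<le> z \<and> z \<le> 2 * 2 ^ k"
proof -
  obtain m where m: "z < 2 ^ m"
    using real_arch_pow[of 2 z] by auto
  define k where "k = (LEAST m. z < 2 ^ m)"
  have k: "z < 2 ^ k"
    unfolding k_def by (rule LeastI[where P = "\<lambda>m. z < 2 ^ m", OF m])
  obtain j where j: "k = Suc j"
    using k assms by (cases k) auto
  have "\<not> z < 2 ^ j"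
    using not_less_Least[of j "\<lambda>m. z < 2 ^ m"] j unfolding k_def by simp
  thus ?thesis
    using k j by (intro exI[of _ j]) auto
qed

lemma powr_minus_le_on_dyadic:
  fixes r t \<beta> :: real
  assumes "0 < r" "r \<le> t" "t \<le> 2 * r"
  shows "t powr - \<beta> \<le> 2 powr \<bar>\<beta>\<bar> * r powr - \<beta>"
proof (cases "\<beta> \<ge> 0")
  case True
  have "t powr - \<beta> \<le> r powr - \<beta>"
    using assms True by (intro powr_mono2') auto
  moreover have "1 \<le> 2 powr \<bar>\<beta>\<bar>"
    by (simp add: ge_one_powr_ge_zero)
  ultimately show ?thesis
    using mult_right_mono[of 1 "2 powr \<bar>\<beta>\<bar>" "r powr - \<beta>"] by simp
next
  case False
  have "t powr - \<beta> \<le> (2 * r) powr - \<beta>"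
    using assms False by (intro powr_mono2) auto
  thus ?thesis
    using assms False by (simp add: powr_mult)
qed

text \<open>
  On a dyadic shell of radius \<open>t\<close> the integrand is comparable to \<open>t\<close> to the power \<open>-\<beta>\<close>, and the
  shell sits in a ball of volume of order \<open>t\<close> to the power \<open>d\<close>, so the shells contribute a
  geometric series of ratio \<open>\<tau>\<close> to the power \<open>d - \<beta>\<close>. Leaving \<open>\<tau>\<close> free covers the singularity
  at \<open>x\<close> (\<open>\<tau> = 1/2\<close>, shrinking shells) and the tail at infinity (\<open>\<tau> = 2\<close>, growing shells) at
  once. The centre \<open>x\<close> may lie in \<open>A\<close> uncovered, since the integrand is \<open>0\<close> there by
  \<open>0 powr e = 0\<close>.
\<close>
lemma nn_integral_powr_dyadic:
  fixes x :: "'a::euclidean_space" and \<beta> \<rho> \<tau> :: real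
  defines "d \<equiv> real DIM('a)"
  assumes \<rho>: "\<rho> > 0" and \<tau>: "\<tau> > 0" "\<tau> powr (d - \<beta>) < 1"
    and cover: "\<And>y. y \<in> A \<Longrightarrow> y \<noteq> x \<Longrightarrow> \<exists>k. \<rho> * \<tau> ^ k \<le> norm (x - y) \<and> norm (x - y) \<le> 2 * (\<rho> * \<tau> ^ k)"
  shows "(\<integral>\<^sup>+y. ennreal (norm (x - y) powr - \<beta>) * indicator A y \<partial>lborel)
    \<le> ennreal (2 powr \<bar>\<beta>\<bar> * unit_ball_vol d * 2 powr d / (1 - \<tau> powr (d - \<beta>)) * \<rho> powr (d - \<beta>))"
proof -
  define r where "r k = \<rho> * \<tau> ^ k" for k :: nat
  have r: "r k > 0" for k
    using \<rho> \<tau> by (simp add: r_def)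
  define K where "K = 2 powr \<bar>\<beta>\<bar> * unit_ball_vol d * 2 powr d"
  have "K \<ge> 0"
    by (simp add: K_def d_def)
  \<comment> \<open>A whole ball in place of the shell loses only a constant factor, and its volume is known.\<close>
  define g where "g k y = ennreal (2 powr \<bar>\<beta>\<bar> * r k powr - \<beta>) * indicator (cball x (2 * r k)) y" for k y
  have g_meas: "g k \<in> borel_measurable lborel" for k
    unfolding g_def by (intro borel_measurable_times_ennreal borel_measurable_indicator) auto
  have int_g: "(\<integral>\<^sup>+y. g k y \<partial>lborel) = ennreal (K * \<rho> powr (d - \<beta>) * (\<tau> powr (d - \<beta>)) ^ k)" for k
  proof -
    have "(\<integral>\<^sup>+y. g k y \<partial>lborel)
        = ennreal (2 powr \<bar>\<beta>\<bar> * r k powr - \<beta>) * ennreal (unit_ball_vol d * (2 * r k) ^ DIM('a))"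
      using r[of k] by (simp add: g_def nn_integral_cmult_indicator emeasure_cball d_def)
    also have "\<dots> = ennreal (2 powr \<bar>\<beta>\<bar> * r k powr - \<beta> * (unit_ball_vol d * (2 * r k) powr d))"
      using r[of k] by (simp add: ennreal_mult d_def powr_realpow)
    also have "2 powr \<bar>\<beta>\<bar> * r k powr - \<beta> * (unit_ball_vol d * (2 * r k) powr d) = K * r k powr (d - \<beta>)"
      using r[of k] by (simp add: K_def powr_mult powr_diff powr_minus field_simps)
    also have "r k powr (d - \<beta>) = \<rho> powr (d - \<beta>) * (\<tau> powr (d - \<beta>)) ^ k"
    proof -
      have "(\<tau> ^ k) powr (d - \<beta>) = (\<tau> powr (d - \<beta>)) ^ k"
        using \<tau> by (simp add: powr_realpow[symmetric] powr_powr mult.commute)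
      thus ?thesis
        using \<rho> \<tau> by (simp add: r_def powr_mult)
    qed
    finally show ?thesis
      by (simp add: mult.assoc)
  qed
  have "ennreal (norm (x - y) powr - \<beta>) * indicator A y \<le> (\<Sum>k. g k y)" for y
  proof (cases "y \<in> A \<and> y \<noteq> x")
    case True
    then obtain k where k: "r k \<le> norm (x - y)" "norm (x - y) \<le> 2 * r k"
      using cover[of y] by (auto simp: r_def)
    have "ennreal (norm (x - y) powr - \<beta>) * indicator A y \<le> g k y"
      using True k powr_minus_le_on_dyadic[OF r k]
      by (auto simp: g_def dist_norm intro!: ennreal_leI)
    also have "\<dots> \<le> (\<Sum>k. g k y)"
      using sum_le_suminf[of "\<lambda>k. g k y" "{k}"] by simp
    finally show ?thesis .
  qed auto
  hence "(\<integral>\<^sup>+y. ennreal (norm (x - y) powr - \<beta>) * indicator A y \<partial>lborel) \<le> (\<integral>\<^sup>+y. (\<Sum>k. g k y) \<partial>lborel)"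
    by (rule nn_integral_mono)
  also have "\<dots> = (\<Sum>k. \<integral>\<^sup>+y. g k y \<partial>lborel)"
    by (rule nn_integral_suminf[OF g_meas])
  also have "\<dots> = (\<Sum>k. ennreal (K * \<rho> powr (d - \<beta>) * (\<tau> powr (d - \<beta>)) ^ k))"
    by (simp only: int_g)
  also have "\<dots> = ennreal (K * \<rho> powr (d - \<beta>) * (1 / (1 - \<tau> powr (d - \<beta>))))"
    using \<open>K \<ge> 0\<close> \<tau> by (intro suminf_ennreal_eq sums_mult geometric_sums) auto
  finally show ?thesis
    by (simp add: K_def)
qed

lemma nn_integral_powr_near:
  fixes \<beta> :: real
  assumes "\<beta> < DIM('a::euclidean_space)"
  shows "\<exists>C\<ge>0. \<forall>(x::'a) \<rho>. \<rho> > 0 \<longrightarrow>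
    (\<integral>\<^sup>+y. ennreal (norm (x - y) powr - \<beta>) * indicator (cball x \<rho>) y \<partial>lborel)
      \<le> ennreal (C * \<rho> powr (DIM('a) - \<beta>))"
proof -
  define d where "d = real DIM('a)"
  define C where "C = 2 powr \<bar>\<beta>\<bar> * unit_ball_vol d * 2 powr d / (1 - (1/2) powr (d - \<beta>))"
  have \<tau>: "(1/2) powr (d - \<beta>) < 1"
    using assms powr_less_mono2[of "d - \<beta>" "1/2" 1] by (simp add: d_def)
  hence C: "C \<ge> 0"
    by (simp add: C_def d_def)
  have "(\<integral>\<^sup>+y. ennreal (norm (x - y) powr - \<beta>) * indicator (cball x \<rho>) y \<partial>lborel)
      \<le> ennreal (C * (1/2) powr (d - \<beta>) * \<rho> powr (d - \<beta>))" if \<rho>: "\<rho> > 0" for x :: 'a and \<rho>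
  proof -
    have "(\<integral>\<^sup>+y. ennreal (norm (x - y) powr - \<beta>) * indicator (cball x \<rho>) y \<partial>lborel)
      \<le> ennreal (C * (\<rho> / 2) powr (d - \<beta>))"
      unfolding C_def d_def
    proof (rule nn_integral_powr_dyadic)
      fix y assume y: "y \<in> cball x \<rho>" "y \<noteq> x"
      define t where "t = norm (x - y)"
      have t: "0 < t" "t \<le> \<rho>"
        using y by (auto simp: t_def dist_norm)
      obtain k where "2 ^ k \<le> \<rho> / t" "\<rho> / t \<le> 2 * 2 ^ k"
        using dyadic_bracket[of "\<rho> / t"] t by auto
      thus "\<exists>k. \<rho> / 2 * (1 / 2) ^ k \<le> norm (x - y) \<and> norm (x - y) \<le> 2 * (\<rho> / 2 * (1 / 2) ^ k)"
        using t by (intro exI[of _ k]) (auto simp: field_simps power_divide simp flip: t_def)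
    qed (use \<tau> \<rho> in \<open>auto simp: d_def\<close>)
    also have "(\<rho> / 2) powr (d - \<beta>) = (1/2) powr (d - \<beta>) * \<rho> powr (d - \<beta>)"
      using powr_mult[of "1/2" \<rho> "d - \<beta>"] \<rho> by simp
    finally show ?thesis
      by (simp add: mult.assoc)
  qed
  thus ?thesis
    using C by (intro exI[of _ "C * (1/2) powr (d - \<beta>)"]) (simp add: d_def)
qed

lemma nn_integral_powr_far:
  fixes \<beta> :: real
  assumes "\<beta> > DIM('a::euclidean_space)"
  shows "\<exists>C\<ge>0. \<forall>(x::'a) \<rho>. \<rho> > 0 \<longrightarrow>
    (\<integral>\<^sup>+y. ennreal (norm (x - y) powr - \<beta>) * indicator (- cball x \<rho>) y \<partial>lborel)
      \<le> ennreal (C * \<rho> powr (DIM('a) - \<beta>))"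
proof -
  define d where "d = real DIM('a)"
  define C where "C = 2 powr \<bar>\<beta>\<bar> * unit_ball_vol d * 2 powr d / (1 - 2 powr (d - \<beta>))"
  have \<tau>: "2 powr (d - \<beta>) < 1"
    using assms powr_less_mono[of "d - \<beta>" 0 2] by (simp add: d_def)
  hence C: "C \<ge> 0"
    by (simp add: C_def d_def)
  have "(\<integral>\<^sup>+y. ennreal (norm (x - y) powr - \<beta>) * indicator (- cball x \<rho>) y \<partial>lborel)
      \<le> ennreal (C * \<rho> powr (d - \<beta>))" if \<rho>: "\<rho> > 0" for x :: 'a and \<rho>
    unfolding C_def d_def
  proof (rule nn_integral_powr_dyadic)
    fix y assume y: "y \<in> - cball x \<rho>"
    define t where "t = norm (x - y)"
    have t: "t > \<rho>"
      using y by (auto simp: t_def dist_norm)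
    obtain k where "2 ^ k \<le> t / \<rho>" "t / \<rho> \<le> 2 * 2 ^ k"
      using dyadic_bracket[of "t / \<rho>"] t \<rho> by auto
    thus "\<exists>k. \<rho> * 2 ^ k \<le> norm (x - y) \<and> norm (x - y) \<le> 2 * (\<rho> * 2 ^ k)"
      using \<rho> by (intro exI[of _ k]) (auto simp: field_simps simp flip: t_def)
  qed (use \<tau> \<rho> in \<open>auto simp: d_def\<close>)
  thus ?thesis
    using C by (intro exI[of _ C]) (simp add: d_def)
qed

lemma nn_integral_inhomogeneous_powr_finite:
  fixes b :: real
  assumes b: "b > DIM('a::euclidean_space)"
  shows "(\<integral>\<^sup>+(x::'a). ennreal ((1 + norm x) powr - b) \<partial>lborel) < \<infinity>"
proof -
  obtain C where C: "(\<integral>\<^sup>+y. ennreal (norm (0 - y :: 'a) powr - b) * indicator (- cball 0 1) y \<partial>lborel) \<le> ennreal C"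
  proof -
    obtain C where "\<And>(x::'a) \<rho>. \<rho> > 0 \<Longrightarrow>
      (\<integral>\<^sup>+y. ennreal (norm (x - y) powr - b) * indicator (- cball x \<rho>) y \<partial>lborel)
        \<le> ennreal (C * \<rho> powr (DIM('a) - b))"
      using nn_integral_powr_far[OF b] by blast
    from this[of 1 0] show ?thesis
      using that by simp
  qed
  have "(\<integral>\<^sup>+(x::'a). ennreal ((1 + norm x) powr - b) \<partial>lborel)
     \<le> (\<integral>\<^sup>+(x::'a). indicator (cball 0 1) x + ennreal (norm (0 - x) powr - b) * indicator (- cball 0 1) x \<partial>lborel)"
  proof (rule nn_integral_mono)
    fix x :: 'a
    show "ennreal ((1 + norm x) powr - b)
      \<le> indicator (cball 0 1) x + ennreal (norm (0 - x) powr - b) * indicator (- cball 0 1) x"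
    proof (cases "x \<in> cball 0 1")
      case True
      have "(1 + norm x) powr - b \<le> 1"
        using b by (simp add: powr_minus inverse_le_1_iff ge_one_powr_ge_zero)
      thus ?thesis
        using True by simp
    next
      case False
      have "(1 + norm x) powr - b \<le> norm x powr - b"
        using b False by (intro powr_mono2') auto
      thus ?thesis
        using False by (simp add: ennreal_leI)
    qed
  qed
  also have "\<dots> \<le> emeasure lborel (cball (0::'a) 1) + ennreal C"
    using C by (subst nn_integral_add) (auto intro!: add_mono borel_measurable_indicator)
  also have "\<dots> < \<infinity>"
    by (simp add: emeasure_cball)
  finally show ?thesis .
qed

section \<open>Decay of the inner integral\<close>

text \<open>
  On the ball of radius \<open>(1 + \<bar>x\<bar>)/2\<close> about \<open>x\<close> the quantity \<open>1 + \<bar>y\<bar>\<close> stays above that radius,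
  so the derivative of \<open>t powr - a\<close> is bounded by its value there.
\<close>
lemma inhomogeneous_powr_lipschitz:
  fixes x y :: "'a::real_normed_vector" and a :: real
  assumes a: "a > 0" and xy: "norm (x - y) \<le> (1 + norm x) / 2"
  shows "\<bar>(1 + norm x) powr - a - (1 + norm y) powr - a\<bar>
    \<le> a * ((1 + norm x) / 2) powr (- a - 1) * norm (x - y)"
proof -
  define m where "m = (1 + norm x) / 2"
  have m: "m > 0"
    by (simp add: m_def add_pos_nonneg)
  have "norm x \<le> norm y + norm (x - y)"
    by (metis norm_triangle_sub add.commute)
  hence in_S: "1 + norm x \<in> {m..}" "1 + norm y \<in> {m..}"
    using xy by (auto simp: m_def field_simps)
  have "norm ((1 + norm x) powr - a - (1 + norm y) powr - a)
    \<le> (a * m powr (- a - 1)) * norm ((1 + norm x) - (1 + norm y))"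
  proof (rule field_differentiable_bound[of "{m..}" "\<lambda>t. t powr - a" "\<lambda>t. - a * t powr (- a - 1)"])
    fix z :: real assume z: "z \<in> {m..}"
    show "((\<lambda>t. t powr - a) has_field_derivative - a * z powr (- a - 1)) (at z within {m..})"
      using z m by (auto intro!: derivative_eq_intros)
    have "z powr (- a - 1) \<le> m powr (- a - 1)"
      using z m a by (intro powr_mono2') auto
    thus "norm (- a * z powr (- a - 1)) \<le> a * m powr (- a - 1)"
      using a by (simp add: abs_mult)
  qed (use in_S in auto)
  also have "\<dots> \<le> (a * m powr (- a - 1)) * norm (x - y)"
    using a norm_triangle_ineq3[of x y] by (intro mult_left_mono) auto
  finally show ?thesis
    by (simp add: m_def)
qed

text \<open>
  Each of the three regions described at the beginning yields a power of the distance to \<open>x\<close> or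
  to the origin, integrated over a ball or its complement. The radius is always proportional to
  \<open>r = 1 + \<bar>x\<bar>\<close>, so that every term scales with the same power of \<open>r\<close>.
\<close>
lemma gagliardo_inner_integral_decay:
  fixes a s q :: real
  defines "u \<equiv> \<lambda>x::'a::euclidean_space. (1 + norm x) powr - a"
  assumes a: "a > 0" and s: "0 < s" "s < 1" and q: "q > 0" and aq: "a * q < DIM('a)"
  shows "\<exists>C\<ge>0. \<forall>x::'a. (\<integral>\<^sup>+y. ennreal (\<bar>u x - u y\<bar> powr q / norm (x - y) powr (DIM('a) + s * q)) \<partial>lborel)
     \<le> ennreal (C * (1 + norm x) powr - ((a + s) * q))"
proof -
  define d where "d = real DIM('a)"
  have sq: "0 < s * q" "0 < (1 - s) * q"
    using s q by auto
  obtain C1 where C1: "C1 \<ge> 0" "\<And>(x::'a) \<rho>. \<rho> > 0 \<Longrightarrow>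
    (\<integral>\<^sup>+y. ennreal (norm (x - y) powr - (d - (1 - s) * q)) * indicator (cball x \<rho>) y \<partial>lborel)
      \<le> ennreal (C1 * \<rho> powr ((1 - s) * q))"
    using nn_integral_powr_near[where 'a = 'a, of "d - (1 - s) * q"] sq by (auto simp: d_def)
  obtain C2 where C2: "C2 \<ge> 0" "\<And>(x::'a) \<rho>. \<rho> > 0 \<Longrightarrow>
    (\<integral>\<^sup>+y. ennreal (norm (x - y) powr - (d + s * q)) * indicator (- cball x \<rho>) y \<partial>lborel)
      \<le> ennreal (C2 * \<rho> powr - (s * q))"
    using nn_integral_powr_far[where 'a = 'a, of "d + s * q"] sq by (auto simp: d_def)
  obtain C3 where C3: "C3 \<ge> 0" "\<And>(x::'a) \<rho>. \<rho> > 0 \<Longrightarrow>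
    (\<integral>\<^sup>+y. ennreal (norm (x - y) powr - (a * q)) * indicator (cball x \<rho>) y \<partial>lborel)
      \<le> ennreal (C3 * \<rho> powr (d - a * q))"
    using nn_integral_powr_near[where 'a = 'a, of "a * q"] aq by (auto simp: d_def)
  define K1 where "K1 = a powr q * (1/2) powr ((- a - 1) * q)"
  define K3 where "K3 = (1/2) powr - (d + s * q)"
  define C where "C = K1 * C1 * (1/2) powr ((1 - s) * q) + 2 * C2 * (1/2) powr - (s * q) + K3 * C3"
  have K: "K1 \<ge> 0" "K3 \<ge> 0"
    by (auto simp: K1_def K3_def)
  have "C \<ge> 0"
    using C1 C2 C3 K by (simp add: C_def)
  moreover have "(\<integral>\<^sup>+y. ennreal (\<bar>u x - u y\<bar> powr q / norm (x - y) powr (d + s * q)) \<partial>lborel)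
     \<le> ennreal (C * (1 + norm x) powr - ((a + s) * q))" for x :: 'a
  proof -
    define r where "r = 1 + norm x"
    have r: "r > 0"
      by (simp add: r_def add_pos_nonneg)
    have half: "(r / 2) powr e = (1/2) powr e * r powr e" for e
      using powr_mult[of "1/2" r e] r by simp
    \<comment> \<open>Coefficients of the near part, of the kernel's tail, and of the mass around the origin.
      The factor 2 covers \<open>u x\<close> and \<open>u y\<close> together when \<open>\<bar>y\<bar> > r\<close>, where \<open>u y \<le> u x\<close>.\<close>
    define c1 c2 c3 where "c1 = K1 * r powr ((- a - 1) * q)"
      and "c2 = 2 * r powr - (a * q)" and "c3 = K3 * r powr - (d + s * q)"
    have c: "c1 \<ge> 0" "c2 \<ge> 0" "c3 \<ge> 0"
      using K by (auto simp: c1_def c2_def c3_def)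
    define f1 where "f1 y = ennreal (norm (x - y) powr - (d - (1 - s) * q)) * indicator (cball x (r / 2)) y" for y
    define f2 where "f2 y = ennreal (norm (x - y) powr - (d + s * q)) * indicator (- cball x (r / 2)) y" for y
    define f3 where "f3 y = ennreal (norm (0 - y) powr - (a * q)) * indicator (cball 0 r) y" for y :: 'a
    have [measurable]: "cball z t \<in> sets borel" for z :: 'a and t
      by simp
    have meas [measurable]: "f1 \<in> borel_measurable lborel" "f2 \<in> borel_measurable lborel" "f3 \<in> borel_measurable lborel"
      unfolding f1_def f2_def f3_def by measurable
    \<comment> \<open>The origin is excluded because \<open>f3 0 = 0\<close> by \<open>0 powr e = 0\<close>, whereas \<open>u 0 = 1\<close>.\<close>
    have pointwise: "ennreal (\<bar>u x - u y\<bar> powr q / norm (x - y) powr (d + s * q))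
        \<le> ennreal c1 * f1 y + ennreal c2 * f2 y + ennreal c3 * f3 y" if y: "y \<noteq> 0" for y
    proof (cases "y \<in> cball x (r / 2)")
      case near: True
      show ?thesis
      proof (cases "x = y")
        case False
        hence t: "norm (x - y) > 0"
          by simp
        have "\<bar>u x - u y\<bar> \<le> a * (r / 2) powr (- a - 1) * norm (x - y)"
          using inhomogeneous_powr_lipschitz[OF a, of x y] near by (simp add: u_def r_def dist_norm)
        hence "\<bar>u x - u y\<bar> powr q \<le> (a * (r / 2) powr (- a - 1) * norm (x - y)) powr q"
          using q by (intro powr_mono2) auto
        also have "\<dots> = c1 * norm (x - y) powr q"
          using a r t by (simp add: powr_mult powr_powr c1_def K1_def half)
        finally have "\<bar>u x - u y\<bar> powr q / norm (x - y) powr (d + s * q)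
          \<le> c1 * norm (x - y) powr q / norm (x - y) powr (d + s * q)"
          by (intro divide_right_mono) auto
        also have "\<dots> = c1 * (norm (x - y) powr q / norm (x - y) powr (d + s * q))"
          by simp
        also have "norm (x - y) powr q / norm (x - y) powr (d + s * q) = norm (x - y) powr - (d - (1 - s) * q)"
          by (simp add: algebra_simps flip: powr_diff)
        finally have "ennreal (\<bar>u x - u y\<bar> powr q / norm (x - y) powr (d + s * q))
          \<le> ennreal c1 * f1 y"
          using near c by (simp add: f1_def ennreal_leI flip: ennreal_mult)
        thus ?thesis
          by (meson add_increasing2 order_trans zero_le)
      qed auto
    next
      case far: False
      hence t: "norm (x - y) > r / 2"
        by (simp add: dist_norm)
      have upos: "u z \<ge> 0" for z
        by (simp add: u_def)
      have "\<bar>u x - u y\<bar> powr q \<le> (max (u x) (u y)) powr q"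
        using q upos[of x] upos[of y] by (intro powr_mono2) auto
      also have "\<dots> \<le> u x powr q + u y powr q"
        by (auto simp: max_def)
      \<comment> \<open>Passing through the maximum avoids subadditivity of the power, which fails for \<open>q > 1\<close>.\<close>
      finally have diff: "\<bar>u x - u y\<bar> powr q \<le> r powr - (a * q) + (1 + norm y) powr - (a * q)"
        by (simp add: u_def powr_powr r_def)
      have quot: "z / norm (x - y) powr (d + s * q) = z * norm (x - y) powr - (d + s * q)" for z
        by (simp only: powr_minus divide_inverse)
      have f2: "f2 y = ennreal (norm (x - y) powr - (d + s * q))"
        using far by (simp add: f2_def)
      show ?thesis
      proof (cases "norm y \<le> r")
        case True
        have "(1 + norm y) powr - (a * q) \<le> norm y powr - (a * q)"
          using a q y by (intro powr_mono2') auto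
        moreover have "norm (x - y) powr - (d + s * q) \<le> (r / 2) powr - (d + s * q)"
          using t r sq by (intro powr_mono2') (auto simp: d_def)
        ultimately have prod: "(1 + norm y) powr - (a * q) * norm (x - y) powr - (d + s * q)
            \<le> norm y powr - (a * q) * c3"
          unfolding half c3_def K3_def by (intro mult_mono) auto
        have "\<bar>u x - u y\<bar> powr q / norm (x - y) powr (d + s * q)
          \<le> (r powr - (a * q) + (1 + norm y) powr - (a * q)) * norm (x - y) powr - (d + s * q)"
          unfolding quot by (rule mult_right_mono[OF diff]) simp
        also have "\<dots> \<le> c2 * norm (x - y) powr - (d + s * q) + c3 * norm y powr - (a * q)"
        proof -
          have "r powr - (a * q) * norm (x - y) powr - (d + s * q) \<le> c2 * norm (x - y) powr - (d + s * q)"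
            by (rule mult_right_mono) (simp_all add: c2_def)
          thus ?thesis
            unfolding distrib_right mult.commute[of c3] using prod by (rule add_mono)
        qed
        finally have "ennreal (\<bar>u x - u y\<bar> powr q / norm (x - y) powr (d + s * q))
          \<le> ennreal c2 * f2 y + ennreal c3 * f3 y"
          using c True by (simp add: f2 f3_def ennreal_leI flip: ennreal_mult ennreal_plus)
        thus ?thesis
          by (simp add: add.assoc add_increasing)
      next
        case False
        have "(1 + norm y) powr - (a * q) \<le> r powr - (a * q)"
          using a q r False by (intro powr_mono2') auto
        hence "\<bar>u x - u y\<bar> powr q \<le> c2"
          using diff by (simp add: c2_def)
        hence "\<bar>u x - u y\<bar> powr q / norm (x - y) powr (d + s * q) \<le> c2 * norm (x - y) powr - (d + s * q)"
          unfolding quot by (rule mult_right_mono) simp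
        hence "ennreal (\<bar>u x - u y\<bar> powr q / norm (x - y) powr (d + s * q)) \<le> ennreal c2 * f2 y"
          using c by (simp add: f2 ennreal_leI flip: ennreal_mult)
        thus ?thesis
          by (meson add_increasing add_increasing2 order_trans zero_le)
      qed
    qed
    have "(\<integral>\<^sup>+y. ennreal (\<bar>u x - u y\<bar> powr q / norm (x - y) powr (d + s * q)) \<partial>lborel)
      \<le> (\<integral>\<^sup>+y. ennreal c1 * f1 y + ennreal c2 * f2 y + ennreal c3 * f3 y \<partial>lborel)"
      using AE_lborel_singleton[of "0::'a"] pointwise by (intro nn_integral_mono_AE) auto
    also have "\<dots> = ennreal c1 * (\<integral>\<^sup>+y. f1 y \<partial>lborel) + ennreal c2 * (\<integral>\<^sup>+y. f2 y \<partial>lborel)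
        + ennreal c3 * (\<integral>\<^sup>+y. f3 y \<partial>lborel)"
      by (simp add: nn_integral_add nn_integral_cmult)
    also have "\<dots> \<le> ennreal c1 * ennreal (C1 * (r / 2) powr ((1 - s) * q))
        + ennreal c2 * ennreal (C2 * (r / 2) powr - (s * q)) + ennreal c3 * ennreal (C3 * r powr (d - a * q))"
      unfolding f1_def f2_def f3_def
      by (intro add_mono mult_left_mono C1(2) C2(2) C3(2)) (use r in auto)
    also have "\<dots> = ennreal (c1 * (C1 * (r / 2) powr ((1 - s) * q))
        + c2 * (C2 * (r / 2) powr - (s * q)) + c3 * (C3 * r powr (d - a * q)))"
      using c C1 C2 C3 by (simp flip: ennreal_mult ennreal_plus)
    also have "c1 * (C1 * (r / 2) powr ((1 - s) * q)) = K1 * C1 * (1/2) powr ((1 - s) * q) * r powr - ((a + s) * q)"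
    proof -
      have "r powr ((- a - 1) * q) * r powr ((1 - s) * q) = r powr - ((a + s) * q)"
        by (simp add: algebra_simps flip: powr_add)
      from this[symmetric] show ?thesis
        by (simp only: c1_def half mult_ac)
    qed
    also have "c2 * (C2 * (r / 2) powr - (s * q)) = 2 * C2 * (1/2) powr - (s * q) * r powr - ((a + s) * q)"
    proof -
      have "r powr - (a * q) * r powr - (s * q) = r powr - ((a + s) * q)"
        by (simp add: algebra_simps flip: powr_add)
      from this[symmetric] show ?thesis
        by (simp only: c2_def half mult_ac)
    qed
    also have "c3 * (C3 * r powr (d - a * q)) = K3 * C3 * r powr - ((a + s) * q)"
    proof -
      have "r powr - (d + s * q) * r powr (d - a * q) = r powr - ((a + s) * q)"
        by (simp add: algebra_simps flip: powr_add)
      from this[symmetric] show ?thesis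
        by (simp only: c3_def mult_ac)
    qed
    finally show ?thesis
      by (simp add: C_def r_def algebra_simps)
  qed
  ultimately show ?thesis
    unfolding d_def by blast
qed

section \<open>Failure of integrability\<close>

text \<open>
  A ball of radius \<open>R\<close> centred at distance \<open>2R\<close> from the origin lies in the region
  \<open>R \<le> \<bar>x\<bar> \<le> 3R\<close>, where the lower bound is in force and of order \<open>R powr - a\<close>. Its share of the
  integral is at least a multiple of \<open>R powr (d - a * p)\<close>, which is unbounded in \<open>R\<close>.
\<close>
lemma nn_integral_powr_slow_decay_infinite:
  fixes f :: "'a::euclidean_space \<Rightarrow> real" and a p \<kappa> \<rho> :: real
  assumes a: "a > 0" and p: "p > 0" and ap: "a * p < DIM('a)" and \<kappa>: "\<kappa> > 0"
    and f: "\<And>x. norm x \<ge> \<rho> \<Longrightarrow> \<kappa> * (1 + norm x) powr - a \<le> \<bar>f x\<bar>"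
  shows "(\<integral>\<^sup>+x. ennreal (\<bar>f x\<bar> powr p) \<partial>lborel) = \<infinity>"
proof -
  define d where "d = real DIM('a)"
  define K where "K = \<kappa> powr p * 4 powr - (a * p) * unit_ball_vol d"
  have "K > 0"
    using \<kappa> by (simp add: K_def d_def)
  have lower: "ennreal (K * R powr (d - a * p)) \<le> (\<integral>\<^sup>+x. ennreal (\<bar>f x\<bar> powr p) \<partial>lborel)"
    if R: "R \<ge> 1" "R \<ge> \<rho>" for R
  proof -
    obtain z :: 'a where z: "norm z = 2 * R"
      using vector_choose_size[of "2 * R"] R by auto
    \<comment> \<open>The constant 4 comes from \<open>1 + \<bar>x\<bar> \<le> 1 + 3 * R \<le> 4 * R\<close>, as \<open>R \<ge> 1\<close>.\<close>
    have pt: "(\<kappa> * (4 * R) powr - a) powr p \<le> \<bar>f x\<bar> powr p" if "x \<in> cball z R" for x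
    proof -
      have "norm z \<le> norm x + dist z x" "norm x \<le> norm z + dist z x"
        by (metis dist_norm norm_triangle_sub add.commute, metis dist_commute dist_norm norm_triangle_sub add.commute)
      hence x: "R \<le> norm x" "norm x \<le> 3 * R"
        using that z by auto
      hence "(4 * R) powr - a \<le> (1 + norm x) powr - a"
        using a R by (intro powr_mono2') auto
      hence "\<kappa> * (4 * R) powr - a \<le> \<kappa> * (1 + norm x) powr - a"
        using \<kappa> by simp
      also have "\<dots> \<le> \<bar>f x\<bar>"
        using f[of x] x R by auto
      finally show ?thesis
        using \<kappa> p by (intro powr_mono2) auto
    qed
    have "(\<kappa> * (4 * R) powr - a) powr p = \<kappa> powr p * 4 powr - (a * p) * R powr - (a * p)"
      using R \<kappa> by (simp add: powr_mult powr_powr)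
    moreover have "R powr (d - a * p) = R powr d * R powr - (a * p)"
      by (simp flip: powr_add)
    ultimately have "ennreal (K * R powr (d - a * p)) = ennreal ((\<kappa> * (4 * R) powr - a) powr p * (unit_ball_vol d * R powr d))"
      by (simp add: K_def mult_ac)
    also have "\<dots> = (\<integral>\<^sup>+x. ennreal ((\<kappa> * (4 * R) powr - a) powr p) * indicator (cball z R) x \<partial>lborel)"
      using R by (simp add: nn_integral_cmult_indicator emeasure_cball d_def ennreal_mult powr_realpow)
    also have "\<dots> \<le> (\<integral>\<^sup>+x. ennreal (\<bar>f x\<bar> powr p) \<partial>lborel)"
      using pt by (intro nn_integral_mono) (auto simp: indicator_def ennreal_leI)
    finally show ?thesis .
  qed
  have unbounded: "ennreal B \<le> (\<integral>\<^sup>+x. ennreal (\<bar>f x\<bar> powr p) \<partial>lborel)" if "B > 0" for B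
  proof -
    define R where "R = max (max 1 \<rho>) ((B / K) powr (1 / (d - a * p)))"
    have "((B / K) powr (1 / (d - a * p))) powr (d - a * p) \<le> R powr (d - a * p)"
      using ap by (intro powr_mono2) (auto simp: R_def d_def)
    hence "B \<le> K * R powr (d - a * p)"
      using ap that \<open>K > 0\<close> by (simp add: powr_powr d_def field_simps)
    moreover have "R \<ge> 1" "R \<ge> \<rho>"
      by (auto simp: R_def)
    ultimately show ?thesis
      using lower[of R] by (meson ennreal_leI order_trans)
  qed
  show ?thesis
  proof (cases "\<integral>\<^sup>+x. ennreal (\<bar>f x\<bar> powr p) \<partial>lborel")
    case (real r)
    thus ?thesis
      using unbounded[of "r + 1"] by (simp add: ennreal_le_iff)
  qed simp
qed

text \<open>
  For \<open>c \<noteq> 0\<close> the difference tends to \<open>\<bar>c\<bar> > 0\<close>, so it eventually dominates a function vanishing at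
  infinity. This reduces all constants to the slow-decay criterion above.
\<close>
lemma inhomogeneous_powr_diff_const_lower_bound:
  fixes a c :: real
  assumes a: "a > 0"
  shows "\<exists>\<kappa>>0. \<exists>\<rho>. \<forall>x::'a::real_normed_vector. norm x \<ge> \<rho> \<longrightarrow>
    \<kappa> * (1 + norm x) powr - a \<le> \<bar>(1 + norm x) powr - a - c\<bar>"
proof (cases "c = 0")
  case True
  thus ?thesis
    by (intro exI[of _ 1]) auto
next
  case False
  have "((\<lambda>t. (1 + t) powr - a) \<longlongrightarrow> 0) at_top"
    using a by (intro tendsto_neg_powr filterlim_tendsto_add_at_top[OF tendsto_const] filterlim_ident) auto
  hence "\<forall>\<^sub>F t in at_top. (1 + t) powr - a < \<bar>c\<bar> / 2"
    using False by (intro order_tendstoD) auto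
  then obtain \<rho> where \<rho>: "\<And>t. t \<ge> \<rho> \<Longrightarrow> (1 + t) powr - a < \<bar>c\<bar> / 2"
    by (auto simp: eventually_at_top_linorder)
  have "1 * (1 + norm x) powr - a \<le> \<bar>(1 + norm x) powr - a - c\<bar>" if "norm x \<ge> \<rho>" for x :: 'a
    using \<rho>[OF that] powr_ge_zero[of "1 + norm x" "- a"] by linarith
  thus ?thesis
    by (intro exI[of _ 1]) auto
qed

section \<open>The slowly decaying example\<close>

theorem proposition1p6:
  fixes s p q :: real
  assumes "CARD('n::finite) \<ge> 2"
    and "0 < s" "s < 1"
    and "0 < p" "s * p < real CARD('n)"
    and "0 < q" "q < real CARD('n) * p / (real CARD('n) - s * p)"
  shows "\<exists>u :: real ^ 'n \<Rightarrow> real. u \<in> homogeneous_W s p q \<and>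
           \<not> (\<exists>c :: real. (\<lambda>x. u x - c) \<in> L_space p)"
proof -
  define n where "n = real CARD('n)"
  have dim: "real DIM(real ^ 'n) = n"
    by (simp add: n_def)
  have n: "n > 0"
    using assms by (simp add: n_def)
  have "n / p - s < n / p" "n / p - s < n / q" "0 < n / p - s"
    using assms n by (auto simp: field_simps simp flip: n_def)
  then obtain a where a: "n / p - s < a" "a < n / p" "a < n / q" "a > 0"
    using dense[of "n / p - s" "min (n / p) (n / q)"] by auto
  \<comment> \<open>The upper bounds on \<open>a\<close> give divergence of the \<open>L\<^sup>p\<close> integral and growth of the local mass
    of \<open>u\<^sup>q\<close>; the lower bound gives convergence of the outer integral.\<close>
  have ap: "a * p < n" and aq: "a * q < n" and asp: "(a + s) * p > n"
    using a assms by (auto simp: field_simps)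
  define u :: "real ^ 'n \<Rightarrow> real" where "u x = (1 + norm x) powr - a" for x
  have u_meas [measurable]: "u \<in> borel_measurable borel"
    unfolding u_def by measurable
  have u_leb: "u \<in> borel_measurable lebesgue"
    using u_meas by (intro measurable_completion) simp
  obtain C where C: "C \<ge> 0" "\<And>x. (\<integral>\<^sup>+y. ennreal (\<bar>u x - u y\<bar> powr q / norm (x - y) powr (n + s * q)) \<partial>lborel)
     \<le> ennreal (C * (1 + norm x) powr - ((a + s) * q))"
    using gagliardo_inner_integral_decay[where 'a = "real ^ 'n", of a s q] assms a aq
    unfolding u_def dim by blast
  have "(\<integral>\<^sup>+x. ennreal_powr (\<integral>\<^sup>+y. ennreal (\<bar>u x - u y\<bar> powr q / norm (x - y) powr (n + s * q)) \<partial>lebesgue) (p / q) \<partial>lebesgue)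
    \<le> (\<integral>\<^sup>+(x::real^'n). ennreal (C powr (p / q)) * ennreal ((1 + norm x) powr - ((a + s) * p)) \<partial>lebesgue)"
  proof (rule nn_integral_mono)
    fix x :: "real ^ 'n"
    define D where "D = (\<integral>\<^sup>+y. ennreal (\<bar>u x - u y\<bar> powr q / norm (x - y) powr (n + s * q)) \<partial>lebesgue)"
    have D: "D \<le> ennreal (C * (1 + norm x) powr - ((a + s) * q))"
      using C(2)[of x] by (simp add: D_def nn_integral_completion)
    hence "D \<noteq> \<infinity>"
      by (metis ennreal_neq_top infinity_ennreal_def neq_top_trans)
    hence "ennreal_powr D (p / q) = ennreal (enn2real D powr (p / q))"
      by (simp add: ennreal_powr_def)
    also have "\<dots> \<le> ennreal ((C * (1 + norm x) powr - ((a + s) * q)) powr (p / q))"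
      using D C(1) assms by (intro ennreal_leI powr_mono2 enn2real_leI) auto
    also have "\<dots> = ennreal (C powr (p / q)) * ennreal ((1 + norm x) powr - ((a + s) * p))"
      using C(1) assms by (simp add: powr_mult powr_powr ennreal_mult)
    finally show "ennreal_powr D (p / q) \<le> ennreal (C powr (p / q)) * ennreal ((1 + norm x) powr - ((a + s) * p))" .
  qed
  also have "\<dots> = ennreal (C powr (p / q)) * (\<integral>\<^sup>+(x::real^'n). ennreal ((1 + norm x) powr - ((a + s) * p)) \<partial>lborel)"
    by (simp add: nn_integral_completion nn_integral_cmult)
  also have "\<dots> < \<infinity>"
    using nn_integral_inhomogeneous_powr_finite[where 'a = "real ^ 'n", of "(a + s) * p"] asp
    by (simp add: ennreal_mult_less_top n_def)
  finally have "u \<in> homogeneous_W s p q"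
    using u_leb by (simp add: homogeneous_W_def n_def)
  moreover have "(\<lambda>x. u x - c) \<notin> L_space p" for c
  proof -
    obtain \<kappa> \<rho> where "\<kappa> > 0" "\<And>x::real^'n. norm x \<ge> \<rho> \<Longrightarrow> \<kappa> * (1 + norm x) powr - a \<le> \<bar>u x - c\<bar>"
      using inhomogeneous_powr_diff_const_lower_bound[OF a(4), where 'a = "real ^ 'n", of c] unfolding u_def by blast
    hence "(\<integral>\<^sup>+x. ennreal (\<bar>u x - c\<bar> powr p) \<partial>lborel) = \<infinity>"
      using a assms ap by (intro nn_integral_powr_slow_decay_infinite[of a p \<kappa> \<rho>]) (auto simp: n_def)
    thus ?thesis
      by (simp add: L_space_def nn_integral_completion)
  qed
  ultimately show ?thesis
    by blast
qed

end
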